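(* Let $N\ge1$, let $\sigma_\theta^2,\sigma_w^2,P,P_T,\gamma>0$, $\sigma_{v,i}^2>0$ and $d_i>0$ ($i=1,\dots,N$), and let $0<\epsilon<P$. Let $h_i=\tilde h_i/d_i^\gamma$ with $\tilde h_1,\dots,\tilde h_N$ independent $\mathcal{CN}(0,1)$ random variables, $\mathbf h=[h_1,\dots,h_N]^T$, $\mathbf H=\mathrm{diag}\{h_1,\dots,h_N\}$, $\mathbf V=\mathrm{diag}\{\sigma_{v,1}^2,\dots,\sigma_{v,N}^2\}$. Let $$\mathbf a_e=\sqrt{\frac{P_T}{N}}\left[\frac1{\sqrt{\sigma_\theta^2+\sigma_{v,1}^2}},\dots,\frac1{\sqrt{\sigma_\theta^2+\sigma_{v,N}^2}}\right]^T$$ be the equal-power gain vector and let $$\mathrm{MSE}=\left(1-\frac{P\,\mathbf a_e^H\mathbf h\mathbf h^H\mathbf a_e}{\mathbf a_e^H\mathbf H\mathbf V\mathbf H^H\mathbf a_e+P\,\mathbf a_e^H\mathbf h\mathbf h^H\mathbf a_e+\sigma_w^2}\right)P$$ be the corresponding (random) MSE. Let $\beta=\frac{P-\epsilon}{\epsilon P}$, $\tilde{\mathbf a}_e=\mathbf a_e/\sqrt{P_T}$, $\mathbf M=\mathrm{diag}\{d_1^{-\gamma},\dots,d_N^{-\gamma}\}$, $$\mathbf Q=\mathrm{diag}\left\{\frac{\sigma_{v,1}^2}{N(\sigma_\theta^2+\sigma_{v,1}^2)d_1^{2\gamma}},\dots,\frac{\sigma_{v,N}^2}{N(\sigma_\theta^2+\sigma_{v,N}^2)d_N^{2\gamma}}\right\},$$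 and let $\lambda_1\ge\lambda_2\ge\dots\ge\lambda_N$ be the eigenvalues of $\mathbf R=\mathbf M\tilde{\mathbf a}_e\tilde{\mathbf a}_e^H\mathbf M-\beta\mathbf Q$. Then the MSE outage probability is $$\Pr\{\mathrm{MSE}>\epsilon\}=\begin{cases}1-\dfrac{\lambda_1^{N-1}}{\prod_{l\ne1}(\lambda_1-\lambda_l)}\,\exp\!\left(-\dfrac{(P-\epsilon)\sigma_w^2}{\epsilon P P_T\lambda_1}\right),&\lambda_1>0,\\[2mm]1,&\lambda_1\le0.\end{cases}$$
   Context: $(\cdot)^H$ is the conjugate transpose; $\mathcal{CN}(0,1)$ is the circularly symmetric complex normal distribution with unit variance. Setting: $N$ sensors at distances $d_i$ (path-loss exponent $\gamma$) observe a parameter of variance $\sigma_\theta^2$ in noises of variances $\sigma_{v,i}^2$ and forward their observations, each with transmit power $P_T/N$, over a coherent multiple access channel to a fusion center with noise variance $\sigma_w^2$ running a Kalman filter with prediction MSE $P=P_{n|n-1}$. *)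

theory Defs
  imports "HOL-Probability.Probability" "Jordan_Normal_Form.Schur_Decomposition"
begin

text \<open>Sensors and eigenvalues are indexed by \<open>0, \<dots>, N - 1\<close>. Vectors in \<open>\<complex>\<^sup>N\<close> are \<open>N \<times> 1\<close>
  matrices, so that the conjugate transpose of vectors and matrices alike is
  \<^const>\<open>mat_adjoint\<close> and a scalar \<open>a\<^sup>H A a\<close> is the entry of a \<open>1 \<times> 1\<close> matrix. Parameters
  with prefix \<open>v\<close> are variances (not standard deviations): \<open>v\<theta>\<close> is \<open>\<sigma>\<^sub>\<theta>\<^sup>2\<close>, \<open>vv i\<close> is \<open>\<sigma>\<^sub>v\<^sub>,\<^sub>i\<^sup>2\<close>,
  \<open>vw\<close> is \<open>\<sigma>\<^sub>w\<^sup>2\<close>.\<close>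

definition col_vec :: "nat \<Rightarrow> (nat \<Rightarrow> complex) \<Rightarrow> complex mat" where
  "col_vec N f = Matrix.mat N 1 (\<lambda>(i, _). f i)"

text \<open>\<open>\<C>\<N>(0,1)\<close>: real and imaginary part are independent and normal with mean \<open>0\<close> and variance
  \<open>1/2\<close> each; the second parameter of \<^const>\<open>normal_density\<close> is the standard deviation.\<close>

definition std_complex_normal :: "'a measure \<Rightarrow> ('a \<Rightarrow> complex) \<Rightarrow> bool" where
  "std_complex_normal S Z \<longleftrightarrow>
     prob_space.indep_var S borel (\<lambda>\<omega>. Re (Z \<omega>)) borel (\<lambda>\<omega>. Im (Z \<omega>)) \<and>
     distributed S lborel (\<lambda>\<omega>. Re (Z \<omega>)) (normal_density 0 (sqrt (1 / 2))) \<and>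
     distributed S lborel (\<lambda>\<omega>. Im (Z \<omega>)) (normal_density 0 (sqrt (1 / 2)))"

definition equal_gain :: "nat \<Rightarrow> real \<Rightarrow> real \<Rightarrow> (nat \<Rightarrow> real) \<Rightarrow> complex mat" where
  "equal_gain N PT v\<theta> vv =
     complex_of_real (sqrt (PT / real N)) \<cdot>\<^sub>m
       col_vec N (\<lambda>i. complex_of_real (1 / sqrt (v\<theta> + vv i)))"

definition channel :: "real \<Rightarrow> (nat \<Rightarrow> real) \<Rightarrow> (nat \<Rightarrow> complex) \<Rightarrow> nat \<Rightarrow> complex" where
  "channel \<gamma> d ht i = ht i / complex_of_real (d i powr \<gamma>)"

text \<open>Both quadratic forms below are those of positive semidefinite Hermitian matrices, so taking
  the real part only changes the type.\<close>

definition signal_power :: "nat \<Rightarrow> complex mat \<Rightarrow> (nat \<Rightarrow> complex) \<Rightarrow> real" where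
  "signal_power N a h =
     Re ((mat_adjoint a * col_vec N h * mat_adjoint (col_vec N h) * a) $$ (0, 0))"

definition obs_noise_power ::
    "nat \<Rightarrow> (nat \<Rightarrow> real) \<Rightarrow> complex mat \<Rightarrow> (nat \<Rightarrow> complex) \<Rightarrow> real" where
  "obs_noise_power N vv a h =
     (let H = mat_diag N h; V = mat_diag N (\<lambda>i. complex_of_real (vv i))
      in Re ((mat_adjoint a * H * V * mat_adjoint H * a) $$ (0, 0)))"

definition mse ::
    "nat \<Rightarrow> real \<Rightarrow> real \<Rightarrow> (nat \<Rightarrow> real) \<Rightarrow> complex mat \<Rightarrow> (nat \<Rightarrow> complex) \<Rightarrow> real" where
  "mse N P vw vv a h =
     (1 - P * signal_power N a h /
            (obs_noise_power N vv a h + P * signal_power N a h + vw)) * P"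

definition loss_mat :: "nat \<Rightarrow> real \<Rightarrow> (nat \<Rightarrow> real) \<Rightarrow> complex mat" where
  "loss_mat N \<gamma> d = mat_diag N (\<lambda>i. complex_of_real (d i powr (- \<gamma>)))"

definition Q_mat ::
    "nat \<Rightarrow> real \<Rightarrow> (nat \<Rightarrow> real) \<Rightarrow> real \<Rightarrow> (nat \<Rightarrow> real) \<Rightarrow> complex mat" where
  "Q_mat N v\<theta> vv \<gamma> d =
     mat_diag N (\<lambda>i. complex_of_real
       (vv i / (real N * (v\<theta> + vv i) * d i powr (2 * \<gamma>))))"

definition R_mat ::
    "nat \<Rightarrow> real \<Rightarrow> real \<Rightarrow> (nat \<Rightarrow> real) \<Rightarrow> real \<Rightarrow> (nat \<Rightarrow> real) \<Rightarrow> real \<Rightarrow> real \<Rightarrow> complex mat" where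
  "R_mat N PT v\<theta> vv \<gamma> d P \<epsilon> =
     (let \<beta> = (P - \<epsilon>) / (\<epsilon> * P);
          u = complex_of_real (1 / sqrt PT) \<cdot>\<^sub>m equal_gain N PT v\<theta> vv;
          M = loss_mat N \<gamma> d
      in M * u * mat_adjoint u * M - complex_of_real \<beta> \<cdot>\<^sub>m Q_mat N v\<theta> vv \<gamma> d)"

text \<open>The eigenvalues are counted with multiplicity.\<close>

definition decreasing_eigenvalues :: "nat \<Rightarrow> complex mat \<Rightarrow> (nat \<Rightarrow> real) \<Rightarrow> bool" where
  "decreasing_eigenvalues N A lam \<longleftrightarrow>
     char_poly A = (\<Prod>l<N. [:- complex_of_real (lam l), 1:]) \<and>
     (\<forall>k l. k \<le> l \<longrightarrow> l < N \<longrightarrow> lam l \<le> lam k)"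

end

(* Write X = |sum_i b_i z_i|^2 - sum_i c_i |z_i|^2 with z_i the independent CN(0,1) variables,
   b_i = d_i^(-gamma) / sqrt (N (v_theta + v_i)) and c_i = beta v_i b_i^2, so that R = b b^T - diag c and
   MSE > epsilon means X < beta v_w / P_T.  Instead of diagonalising R, integrate out the z_i one
   after the other: the family exp (eta |sum b_i z_i + mu|^2 - sum a_i |z_i|^2) is closed under this
   elimination, and the matrix determinant lemma turns the resulting moment generating function of X
   into prod_l 1 / (1 - theta lambda_l).  This is the moment generating function of
   Y = sum_l lambda_l E_l with independent standard exponential E_l, so X and Y have the same law.
   The secular equation sum_i b_i^2 / (s + c_i) = 1 has at most one positive root, and that root is
   simple; hence at most lambda_1 is positive and Pr (Y >= t) follows by conditioning on the other E_l. *)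

theory Submission
  imports Defs "HOL-Complex_Analysis.Complex_Analysis"
begin

section \<open>Uniqueness of a real law whose moment generating function is finite near 0\<close>

section \<open>Distributions with equal moment generating functions\<close>

text \<open>Differentiation under the integral sign. Integrability at real arguments suffices
  because \<open>norm (exp (z * x))\<close> is \<open>exp (Re z * x)\<close>. Dominated convergence
  needs a bound on the difference quotients that is uniform in the increment; the gap between
  \<open>\<bar>Re z0\<bar>\<close> and \<open>\<delta>\<close> leaves room for one.\<close>

lemma mgf_holomorphic_on_strip:
  assumes "real_distribution M"
    and int: "\<And>\<theta>. \<bar>\<theta>\<bar> < \<delta> \<Longrightarrow> integrable M (\<lambda>x. exp (\<theta> * x))"
  shows "(\<lambda>z. CLINT x|M. exp (z * complex_of_real x)) holomorphic_on {z. \<bar>Re z\<bar> < \<delta>}"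
proof (rule holomorphic_onI)
  interpret real_distribution M by fact
  have [simp]: "sets M = sets borel" by (rule events_eq_borel)
  have dom: "integrable M (\<lambda>x. exp (\<theta> * x) + exp (- \<theta> * x))" if "\<bar>\<theta>\<bar> < \<delta>" for \<theta>
    using int[of \<theta>] int[of "- \<theta>"] that by simp
  have int_c: "integrable M (\<lambda>x. exp (z * complex_of_real x))" if "\<bar>Re z\<bar> < \<delta>" for z
    by (rule Bochner_Integration.integrable_bound[OF int[OF that]]) auto
  fix z0 :: complex assume "z0 \<in> {z. \<bar>Re z\<bar> < \<delta>}"
  then have z0: "\<bar>Re z0\<bar> < \<delta>" by simp
  \<comment> \<open>A third of the distance to the edge of the strip: one \<open>r\<close> is spent
    on the increment \<open>h\<close>, a second on absorbing the factor \<open>\<bar>x\<bar>\<close>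
    through \<open>\<bar>x\<bar> \<le> exp (r * \<bar>x\<bar>) / r\<close>, and the third keeps
    \<open>\<rho>\<close> below \<open>\<delta>\<close>.\<close>
  define r where "r = (\<delta> - \<bar>Re z0\<bar>) / 3"
  define \<rho> where "\<rho> = \<bar>Re z0\<bar> + 2 * r"
  have r: "r > 0" using z0 by (simp add: r_def)
  have "\<rho> = \<delta> - r" by (simp add: r_def \<rho>_def field_simps)
  then have \<rho>: "\<bar>\<rho>\<bar> < \<delta>" using r z0 by (simp add: \<rho>_def)
  let ?q = "\<lambda>h x. (exp ((z0 + h) * complex_of_real x) - exp (z0 * complex_of_real x)) / h"
  have bound: "norm (?q h x) \<le> (exp (\<rho> * x) + exp (- \<rho> * x)) / r"
    if h: "h \<noteq> 0" "norm h < r" for h x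
  proof -
    have "?q h x = exp (z0 * x) * (exp (h * x) - 1) / h"
      by (simp add: ring_distribs exp_add)
    then have "norm (?q h x) = exp (Re z0 * x) * norm (exp (h * x) - 1) / norm h"
      by (simp only: norm_mult norm_divide norm_exp_eq_Re) simp
    also have "norm (exp (h * x) - 1) \<le> exp \<bar>Re (h * x)\<bar> * norm (h * x)"
      using Taylor_exp[of "h * x" 0] by simp
    also have "exp (Re z0 * x) * (exp \<bar>Re (h * x)\<bar> * norm (h * x)) / norm h
        = exp (Re z0 * x) * exp \<bar>Re (h * x)\<bar> * \<bar>x\<bar>"
      using h by (simp add: norm_mult)
    also have "\<dots> \<le> exp (\<bar>Re z0\<bar> * \<bar>x\<bar>) * exp (r * \<bar>x\<bar>) * (exp (r * \<bar>x\<bar>) / r)"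
    proof (intro mult_mono)
      show "exp (Re z0 * x) \<le> exp (\<bar>Re z0\<bar> * \<bar>x\<bar>)"
        by (metis abs_ge_self abs_mult exp_le_cancel_iff)
      have "\<bar>Re h\<bar> \<le> r" using abs_Re_le_cmod[of h] h by linarith
      then show "exp \<bar>Re (h * x)\<bar> \<le> exp (r * \<bar>x\<bar>)"
        by (simp add: abs_mult mult_right_mono)
      have "r * \<bar>x\<bar> \<le> exp (r * \<bar>x\<bar>)"
        using exp_ge_add_one_self[of "r * \<bar>x\<bar>"] by linarith
      then show "\<bar>x\<bar> \<le> exp (r * \<bar>x\<bar>) / r" using r by (simp add: field_simps)
    qed auto
    also have "\<dots> = exp (\<rho> * \<bar>x\<bar>) / r"
      by (simp add: \<rho>_def exp_add[symmetric] ring_distribs)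
    also have "\<dots> \<le> (exp (\<rho> * x) + exp (- \<rho> * x)) / r"
      using r by (intro divide_right_mono) (auto simp: abs_if)
    finally show ?thesis using h by (simp add: divide_right_mono mult_left_mono)
  qed
  \<comment> \<open>Dominated convergence speaks about sequences, so the limit is taken along them.
    Inside the ball \<open>bound\<close> covers every term; being open, the ball is dropped from the
    filter afterwards.\<close>
  have "((\<lambda>h. CLINT x|M. ?q h x) \<longlongrightarrow> (CLINT x|M. complex_of_real x * exp (z0 * x))) (at 0 within ball 0 r)"
    unfolding tendsto_at_iff_sequentially
  proof (intro allI impI)
    fix X :: "nat \<Rightarrow> complex" assume X: "\<forall>i. X i \<in> ball 0 r - {0}" and "X \<longlonglongrightarrow> 0"
    then have X0: "filterlim X (at 0) sequentially" by (auto simp: filterlim_at)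
    show "((\<lambda>h. CLINT x|M. ?q h x) \<circ> X) \<longlonglongrightarrow> (CLINT x|M. complex_of_real x * exp (z0 * x))"
      unfolding comp_def
    proof (rule integral_dominated_convergence[where w = "\<lambda>x. (exp (\<rho> * x) + exp (- \<rho> * x)) / r"])
      show "AE x in M. (\<lambda>i. ?q (X i) x) \<longlonglongrightarrow> complex_of_real x * exp (z0 * x)"
      proof (rule AE_I2)
        fix x
        have "((\<lambda>z. exp (z * complex_of_real x)) has_field_derivative complex_of_real x * exp (z0 * x)) (at z0)"
          by (auto intro!: derivative_eq_intros)
        then have "((\<lambda>h. ?q h x) \<longlongrightarrow> complex_of_real x * exp (z0 * x)) (at 0)"
          by (simp add: DERIV_def)
        from filterlim_compose[OF this X0]
        show "(\<lambda>i. ?q (X i) x) \<longlonglongrightarrow> complex_of_real x * exp (z0 * x)" .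
      qed
      show "integrable M (\<lambda>x. (exp (\<rho> * x) + exp (- \<rho> * x)) / r)"
        using dom[OF \<rho>] by simp
      show "AE x in M. norm (?q (X i) x) \<le> (exp (\<rho> * x) + exp (- \<rho> * x)) / r" for i
        using X by (intro AE_I2 bound) auto
    qed simp_all
  qed
  moreover have "at 0 within ball 0 r = at (0 :: complex)"
    using r by (intro at_within_open) auto
  ultimately have lim: "((\<lambda>h. CLINT x|M. ?q h x) \<longlongrightarrow> (CLINT x|M. complex_of_real x * exp (z0 * x))) (at 0)"
    by simp
  have ev: "\<forall>\<^sub>F h in at 0. (CLINT x|M. ?q h x) =
      ((CLINT x|M. exp ((z0 + h) * complex_of_real x)) - (CLINT x|M. exp (z0 * complex_of_real x))) / h"
    unfolding eventually_at
  proof (intro exI[of _ r] conjI ballI impI r)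
    fix h :: complex assume "h \<noteq> 0 \<and> dist h 0 < r"
    then have "\<bar>Re h\<bar> < r" using abs_Re_le_cmod[of h] by (auto intro: le_less_trans)
    then have "\<bar>Re (z0 + h)\<bar> < \<delta>" using z0 by (simp add: r_def)
    then show "(CLINT x|M. ?q h x) =
      ((CLINT x|M. exp ((z0 + h) * complex_of_real x)) - (CLINT x|M. exp (z0 * complex_of_real x))) / h"
      using int_c[of "z0 + h"] int_c[of z0] z0 by simp
  qed
  have "((\<lambda>z. CLINT x|M. exp (z * complex_of_real x)) has_field_derivative
      (CLINT x|M. complex_of_real x * exp (z0 * x))) (at z0)"
    unfolding DERIV_def using Lim_transform_eventually[OF lim ev] .
  then show "(\<lambda>z. CLINT x|M. exp (z * complex_of_real x)) field_differentiable
      at z0 within {z. \<bar>Re z\<bar> < \<delta>}"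
    using field_differentiable_at_within field_differentiable_def by blast
qed

text \<open>Both moment generating functions extend holomorphically to the strip and agree on a real
  segment accumulating at 0, hence on the imaginary axis, where they are the characteristic
  functions; Levy uniqueness concludes. Finiteness for \<open>M'\<close> is inherited from
  \<open>M\<close> through \<open>eq\<close>.\<close>

lemma real_distribution_eqI_mgf:
  assumes "real_distribution M" "real_distribution M'" "0 < \<delta>"
    and eq: "\<And>\<theta>. \<bar>\<theta>\<bar> < \<delta> \<Longrightarrow>
      (\<integral>\<^sup>+x. ennreal (exp (\<theta> * x)) \<partial>M) = (\<integral>\<^sup>+x. ennreal (exp (\<theta> * x)) \<partial>M')"
    and fin: "\<And>\<theta>. \<bar>\<theta>\<bar> < \<delta> \<Longrightarrow> (\<integral>\<^sup>+x. ennreal (exp (\<theta> * x)) \<partial>M) < \<infinity>"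
  shows "M = M'"
proof (rule Levy_uniqueness[OF assms(1,2)])
  interpret M: real_distribution M by fact
  interpret M': real_distribution M' by fact
  have int: "integrable M (\<lambda>x. exp (\<theta> * x))" "integrable M' (\<lambda>x. exp (\<theta> * x))" if "\<bar>\<theta>\<bar> < \<delta>" for \<theta>
    using fin[OF that] eq[OF that] by (auto intro!: integrableI_nonneg)
  let ?F = "\<lambda>M z. CLINT x|M. exp (z * complex_of_real x)"
  let ?S = "{z. \<bar>Re z\<bar> < \<delta>}"
  have S: "?S = {z. Re z < \<delta>} \<inter> {z. Re z > - \<delta>}" by auto
  have real: "?F M (of_real \<theta>) - ?F M' (of_real \<theta>) = 0" if "\<bar>\<theta>\<bar> < \<delta>" for \<theta>
  proof -
    have *: "?F L (of_real \<theta>) = of_real (LINT x|L. exp (\<theta> * x))" for L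
      by (simp add: of_real_exp flip: of_real_mult integral_complex_of_real)
    have "(LINT x|M. exp (\<theta> * x)) = (LINT x|M'. exp (\<theta> * x))"
      using eq[OF that] by (simp add: integral_eq_nn_integral)
    then show ?thesis by (simp add: *)
  qed
  have "?F M z - ?F M' z = 0" if "z \<in> ?S" for z
  proof (rule analytic_continuation[where f = "\<lambda>z. ?F M z - ?F M' z" and S = ?S
        and U = "of_real ` {-\<delta><..<\<delta>}" and \<xi> = 0])
    show "(\<lambda>z. ?F M z - ?F M' z) holomorphic_on ?S"
      using mgf_holomorphic_on_strip[OF assms(1) int(1)] mgf_holomorphic_on_strip[OF assms(2) int(2)]
      by (intro holomorphic_intros)
    show "open ?S" unfolding S by (intro open_Int open_halfspace_Re_lt open_halfspace_Re_gt)
    show "connected ?S" unfolding S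
      by (intro convex_connected convex_Int convex_halfspace_Re_lt convex_halfspace_Re_gt)
    show "0 islimpt complex_of_real ` {-\<delta><..<\<delta>}"
      unfolding islimpt_approachable
    proof (intro allI impI)
      fix e :: real assume "e > 0"
      then show "\<exists>x'\<in>complex_of_real ` {-\<delta><..<\<delta>}. x' \<noteq> 0 \<and> dist x' 0 < e"
        using \<open>0 < \<delta>\<close>
        by (intro bexI[of _ "of_real (min \<delta> e / 2)"] imageI) (auto simp: min_def)
    qed
  qed (use real that \<open>0 < \<delta>\<close> in auto)
  then have "?F M (\<i> * complex_of_real t) = ?F M' (\<i> * complex_of_real t)" for t
    using \<open>0 < \<delta>\<close> by simp
  then show "char M = char M'"
    by (simp add: char_def fun_eq_iff mult.assoc)
qed

section \<open>Elimination of complex Gaussian variables one at a time\<close>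

section \<open>Gaussian integrals of rank-one quadratic forms\<close>

definition complex_normal :: "complex measure" where
  "complex_normal =
     distr (density lborel (normal_density 0 (sqrt (1 / 2))) \<Otimes>\<^sub>M
            density lborel (normal_density 0 (sqrt (1 / 2)))) borel (\<lambda>(x, y). Complex x y)"

lemma measurable_Complex [measurable]:
  assumes [measurable]: "f \<in> borel_measurable M" "g \<in> borel_measurable M"
  shows "(\<lambda>x. Complex (f x) (g x)) \<in> borel_measurable M"
  unfolding Complex_eq by measurable

lemma sets_complex_normal [simp, measurable_cong]: "sets complex_normal = sets borel"
  by (simp add: complex_normal_def)

lemma prob_space_complex_normal: "prob_space complex_normal"
proof -
  interpret N: prob_space "density lborel (normal_density 0 (sqrt (1 / 2)))"
    by (rule prob_space_normal_density) simp
  interpret NN: pair_prob_space "density lborel (normal_density 0 (sqrt (1 / 2)))"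
    "density lborel (normal_density 0 (sqrt (1 / 2)))" ..
  show ?thesis
    unfolding complex_normal_def by (rule NN.prob_space_distr) simp
qed

text \<open>Completing the square: the density contributes \<open>- x\<^sup>2\<close> to the
  exponent, so \<open>- K\<close> is the total coefficient of the square. For \<open>K > 0\<close>
  the integrand is a constant times the normal density with mean \<open>\<eta> * b * m / K\<close>
  and variance \<open>1 / (2 * K)\<close>.\<close>

lemma nn_integral_normal_exp_quadratic:
  fixes a b m \<eta> :: real
  defines "K \<equiv> 1 + a - \<eta> * b\<^sup>2"
  assumes "K > 0"
  shows "(\<integral>\<^sup>+x. ennreal (exp (\<eta> * (b * x + m)\<^sup>2 - a * x\<^sup>2)) \<partial>density lborel (normal_density 0 (sqrt (1 / 2))))
    = ennreal (exp (\<eta> * (1 + a) / K * m\<^sup>2) / sqrt K)"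
proof -
  define C where "C = exp (\<eta> * (1 + a) / K * m\<^sup>2) / sqrt K"
  have C: "C \<ge> 0" using \<open>K > 0\<close> by (simp add: C_def)
  let ?nd = "normal_density (\<eta> * b * m / K) (sqrt (1 / (2 * K)))"
  have eq: "normal_density 0 (sqrt (1 / 2)) x * exp (\<eta> * (b * x + m)\<^sup>2 - a * x\<^sup>2) = C * ?nd x" for x
  proof -
    have "- x\<^sup>2 + (\<eta> * (b * x + m)\<^sup>2 - a * x\<^sup>2)
        = \<eta> * (1 + a) / K * m\<^sup>2 - K * (x - \<eta> * b * m / K)\<^sup>2"
      using \<open>K > 0\<close> by (simp add: field_simps power2_eq_square) (simp add: K_def algebra_simps power2_eq_square)
    then have "exp (- x\<^sup>2) * exp (\<eta> * (b * x + m)\<^sup>2 - a * x\<^sup>2)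
        = exp (\<eta> * (1 + a) / K * m\<^sup>2) * exp (- (K * (x - \<eta> * b * m / K)\<^sup>2))"
      by (simp add: mult_exp_exp)
    then show ?thesis
      using \<open>K > 0\<close> by (simp add: C_def normal_density_def real_sqrt_divide field_simps)
  qed
  interpret nd: prob_space "density lborel ?nd"
    using \<open>K > 0\<close> by (intro prob_space_normal_density) simp
  have "(\<integral>\<^sup>+x. ennreal (exp (\<eta> * (b * x + m)\<^sup>2 - a * x\<^sup>2)) \<partial>density lborel (normal_density 0 (sqrt (1 / 2))))
      = (\<integral>\<^sup>+x. ennreal (C * ?nd x) \<partial>lborel)"
    by (simp add: nn_integral_density ennreal_mult'[symmetric] eq)
  also have "\<dots> = ennreal C * (\<integral>\<^sup>+x. ennreal (?nd x) \<partial>lborel)"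
    using C by (subst nn_integral_cmult[symmetric]) (auto simp: ennreal_mult)
  also have "(\<integral>\<^sup>+x. ennreal (?nd x) \<partial>lborel) = 1"
    using nd.emeasure_space_1 by (simp add: emeasure_density)
  finally show ?thesis by (simp add: C_def)
qed

text \<open>As \<open>b\<close> is real, the exponent splits into a part in \<open>Re z\<close> and
  one in \<open>Im z\<close>. The two real integrals each give a factor \<open>1 / sqrt K\<close>,
  which makes the square root disappear.\<close>

lemma nn_integral_complex_normal_exp_quadratic:
  fixes a b \<eta> :: real and \<mu> :: complex
  defines "K \<equiv> 1 + a - \<eta> * b\<^sup>2"
  assumes "K > 0"
  shows "(\<integral>\<^sup>+z. ennreal (exp (\<eta> * (cmod (of_real b * z + \<mu>))\<^sup>2 - a * (cmod z)\<^sup>2)) \<partial>complex_normal)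
    = ennreal (exp (\<eta> * (1 + a) / K * (cmod \<mu>)\<^sup>2) / K)"
proof -
  let ?N = "density lborel (normal_density 0 (sqrt (1 / 2)))"
  interpret N: prob_space ?N
    by (rule prob_space_normal_density) simp
  let ?e = "\<lambda>m x. ennreal (exp (\<eta> * (b * x + m)\<^sup>2 - a * x\<^sup>2))"
  have "(\<integral>\<^sup>+z. ennreal (exp (\<eta> * (cmod (of_real b * z + \<mu>))\<^sup>2 - a * (cmod z)\<^sup>2)) \<partial>complex_normal)
      = (\<integral>\<^sup>+p. ?e (Re \<mu>) (fst p) * ?e (Im \<mu>) (snd p) \<partial>(?N \<Otimes>\<^sub>M ?N))"
    unfolding complex_normal_def
    by (subst nn_integral_distr)
       (auto intro!: nn_integral_cong simp: cmod_power2 mult_exp_exp ennreal_mult[symmetric] algebra_simps)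
  also have "\<dots> = (\<integral>\<^sup>+x. \<integral>\<^sup>+y. ?e (Re \<mu>) x * ?e (Im \<mu>) y \<partial>?N \<partial>?N)"
    by (subst N.nn_integral_fst[symmetric]) auto
  also have "\<dots> = ennreal (exp (\<eta> * (1 + a) / K * (Re \<mu>)\<^sup>2) / sqrt K)
      * ennreal (exp (\<eta> * (1 + a) / K * (Im \<mu>)\<^sup>2) / sqrt K)"
    using assms by (simp add: nn_integral_cmult nn_integral_multc nn_integral_normal_exp_quadratic)
  also have "\<dots> = ennreal (exp (\<eta> * (1 + a) / K * (cmod \<mu>)\<^sup>2) / K)"
    using \<open>K > 0\<close> by (simp add: ennreal_mult[symmetric] mult_exp_exp cmod_power2 ring_distribs)
  finally show ?thesis .
qed

text \<open>The offset \<open>\<mu>\<close> makes the induction work: with \<open>z i = y\<close>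
  fixed, the integral over the other variables is the same problem with offset
  \<open>b i * y + \<mu>\<close>. Its value is again a Gaussian exponential in \<open>y\<close>, to
  which the one-variable formula applies.\<close>

lemma nn_integral_PiM_complex_normal_exp_rank_one:
  fixes a b :: "'i \<Rightarrow> real" and \<eta> :: real and \<mu> :: complex
  assumes "finite I"
    and "\<And>i. i \<in> I \<Longrightarrow> 1 + a i > 0"
    and "\<eta> * (\<Sum>i\<in>I. (b i)\<^sup>2 / (1 + a i)) < 1"
  shows "(\<integral>\<^sup>+z. ennreal (exp (\<eta> * (cmod ((\<Sum>i\<in>I. of_real (b i) * z i) + \<mu>))\<^sup>2 - (\<Sum>i\<in>I. a i * (cmod (z i))\<^sup>2)))
      \<partial>PiM I (\<lambda>_. complex_normal))
    = ennreal (exp (\<eta> / (1 - \<eta> * (\<Sum>i\<in>I. (b i)\<^sup>2 / (1 + a i))) * (cmod \<mu>)\<^sup>2)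
        / ((\<Prod>i\<in>I. 1 + a i) * (1 - \<eta> * (\<Sum>i\<in>I. (b i)\<^sup>2 / (1 + a i)))))"
  using assms
proof (induction I arbitrary: \<mu> rule: finite_induct)
  case empty
  interpret product_sigma_finite "\<lambda>_. complex_normal"
    by (intro product_sigma_finite.intro prob_space_imp_sigma_finite prob_space_complex_normal)
  show ?case by (simp add: PiM_empty)
next
  case (insert i I)
  interpret product_sigma_finite "\<lambda>_. complex_normal"
    by (intro product_sigma_finite.intro prob_space_imp_sigma_finite prob_space_complex_normal)
  define W where "W = (\<Sum>i\<in>I. (b i)\<^sup>2 / (1 + a i))"
  define A where "A = 1 + a i"
  define p where "p = (\<Prod>i\<in>I. 1 + a i)"
  have A: "A > 0" and p: "p > 0" using insert.prems by (auto simp: A_def p_def intro!: prod_pos)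
  have W0: "W \<ge> 0" unfolding W_def using insert.prems by (intro sum_nonneg divide_nonneg_pos) auto
  have W': "(\<Sum>i\<in>insert i I. (b i)\<^sup>2 / (1 + a i)) = W + (b i)\<^sup>2 / A"
    using insert.hyps by (simp add: W_def A_def)
  have lt: "\<eta> * (W + (b i)\<^sup>2 / A) < 1" using insert.prems(2) W' by simp
  \<comment> \<open>Smallness passes to the subset for either sign of \<open>\<eta>\<close>; both
    signs occur, since the moment generating function is used on both sides of 0.\<close>
  have lt': "\<eta> * W < 1"
  proof (cases "\<eta> \<ge> 0")
    case True
    then have "\<eta> * W \<le> \<eta> * (W + (b i)\<^sup>2 / A)" using A by (intro mult_left_mono) auto
    then show ?thesis using lt by simp
  next
    case False
    then have "\<eta> * W \<le> 0" using W0 by (simp add: mult_nonpos_nonneg)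
    then show ?thesis by simp
  qed
  \<comment> \<open>The coefficient of the squared modulus that remains after the variables in
    \<open>I\<close> are integrated out.\<close>
  define \<eta>' where "\<eta>' = \<eta> / (1 - \<eta> * W)"
  define K where "K = A - \<eta>' * (b i)\<^sup>2"
  \<comment> \<open>The new pivot is \<open>A\<close> times the quotient of the new and the old
    bracket, so the brackets telescope and only the last one survives in the denominator.\<close>
  have K_eq: "K = A * (1 - \<eta> * (W + (b i)\<^sup>2 / A)) / (1 - \<eta> * W)"
    unfolding K_def \<eta>'_def using A lt' by (simp add: field_simps)
  then have K: "K > 0" using A lt lt' by simp
  have IH: "(\<integral>\<^sup>+z. ennreal (exp (\<eta> * (cmod ((\<Sum>i\<in>I. of_real (b i) * z i) + \<mu>))\<^sup>2
          - (\<Sum>i\<in>I. a i * (cmod (z i))\<^sup>2))) \<partial>PiM I (\<lambda>_. complex_normal))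
      = ennreal (exp (\<eta>' * (cmod \<mu>)\<^sup>2) / (p * (1 - \<eta> * W)))" for \<mu>
    using insert.IH[of \<mu>] insert.prems lt' by (simp add: W_def p_def \<eta>'_def)
  let ?f = "\<lambda>z. ennreal (exp (\<eta> * (cmod ((\<Sum>i\<in>insert i I. of_real (b i) * z i) + \<mu>))\<^sup>2
      - (\<Sum>i\<in>insert i I. a i * (cmod (z i))\<^sup>2)))"
  have f_upd: "?f (z(i := y)) = ennreal (exp (- a i * (cmod y)\<^sup>2)) *
      ennreal (exp (\<eta> * (cmod ((\<Sum>i\<in>I. of_real (b i) * z i) + (of_real (b i) * y + \<mu>)))\<^sup>2
          - (\<Sum>i\<in>I. a i * (cmod (z i))\<^sup>2)))" for y z
  proof -
    have "(\<Sum>j\<in>I. of_real (b j) * (z(i := y)) j) = (\<Sum>j\<in>I. of_real (b j) * z j)"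
      "(\<Sum>j\<in>I. a j * (cmod ((z(i := y)) j))\<^sup>2) = (\<Sum>j\<in>I. a j * (cmod (z j))\<^sup>2)"
      using insert.hyps by (auto intro!: sum.cong)
    then show ?thesis
      using insert.hyps by (simp add: ennreal_mult[symmetric] mult_exp_exp algebra_simps)
  qed
  \<comment> \<open>The new variable is put outermost, so that the inner integral is the one of the
    induction hypothesis.\<close>
  have "(\<integral>\<^sup>+z. ?f z \<partial>PiM (insert i I) (\<lambda>_. complex_normal))
      = (\<integral>\<^sup>+y. \<integral>\<^sup>+z. ?f (z(i := y)) \<partial>PiM I (\<lambda>_. complex_normal) \<partial>complex_normal)"
    using insert.hyps by (intro product_nn_integral_insert_rev) measurable
  also have "\<dots> = (\<integral>\<^sup>+y. ennreal (exp (- a i * (cmod y)\<^sup>2)) *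
      ennreal (exp (\<eta>' * (cmod (of_real (b i) * y + \<mu>))\<^sup>2) / (p * (1 - \<eta> * W))) \<partial>complex_normal)"
    unfolding f_upd by (subst nn_integral_cmult) (simp_all add: IH)
  also have "\<dots> = (\<integral>\<^sup>+y. ennreal (1 / (p * (1 - \<eta> * W))) *
      ennreal (exp (\<eta>' * (cmod (of_real (b i) * y + \<mu>))\<^sup>2 - a i * (cmod y)\<^sup>2)) \<partial>complex_normal)"
    using p lt' by (intro nn_integral_cong) (simp add: ennreal_mult[symmetric] mult_exp_exp)
  also have "\<dots> = ennreal (1 / (p * (1 - \<eta> * W))) * ennreal (exp (\<eta>' * A / K * (cmod \<mu>)\<^sup>2) / K)"
    using K by (subst nn_integral_cmult) (simp_all add: nn_integral_complex_normal_exp_quadratic K_def A_def)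
  also have "\<dots> = ennreal (1 / (p * (1 - \<eta> * W)) * (exp (\<eta>' * A / K * (cmod \<mu>)\<^sup>2) / K))"
    using K p lt' by (subst ennreal_mult) auto
  also have "\<eta>' * A / K = \<eta> / (1 - \<eta> * (W + (b i)\<^sup>2 / A))"
    unfolding K_eq \<eta>'_def using A lt' by simp
  also have "1 / (p * (1 - \<eta> * W)) * (exp (\<eta> / (1 - \<eta> * (W + (b i)\<^sup>2 / A)) * (cmod \<mu>)\<^sup>2) / K)
      = exp (\<eta> / (1 - \<eta> * (W + (b i)\<^sup>2 / A)) * (cmod \<mu>)\<^sup>2) / (A * p * (1 - \<eta> * (W + (b i)\<^sup>2 / A)))"
    unfolding K_eq using A p lt lt' by simp
  finally show ?case
    unfolding W' using insert.hyps by (simp add: A_def p_def)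
qed

section \<open>The secular function of \<open>R_mat\<close>, and the received powers in the same
  coefficients\<close>

section \<open>The matrix R and the quadratic forms of the channel\<close>

text \<open>The matrix determinant lemma, by computing the determinant of the bordered matrix
  \<open>?B\<close> in two ways. The unit triangular factor \<open>?L\<close> clears the bottom row
  and leaves \<open>?E\<close>; the unit triangular factor \<open>?T\<close> clears the last column
  and leaves the Schur complement \<open>?s\<close> beside the diagonal matrix.\<close>

lemma det_diag_minus_rank_one:
  fixes f u v :: "nat \<Rightarrow> 'a :: field"
  assumes f: "\<And>i. i < n \<Longrightarrow> f i \<noteq> 0"
  shows "Determinant.det (Matrix.mat n n (\<lambda>(i, j). (if i = j then f i else 0) - u i * v j))
    = (\<Prod>i<n. f i) * (1 - (\<Sum>i<n. u i * v i / f i))"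
proof -
  let ?D = "mat_diag n f"
  let ?U = "Matrix.mat n 1 (\<lambda>(i, _). u i)"
  let ?V = "Matrix.mat 1 n (\<lambda>(_, j). v j)"
  let ?W = "Matrix.mat n 1 (\<lambda>(i, _). - u i / f i)"
  let ?E = "Matrix.mat n n (\<lambda>(i, j). (if i = j then f i else 0) - u i * v j)"
  let ?s = "Matrix.mat 1 1 (\<lambda>_. 1 - (\<Sum>i<n. u i * v i / f i))"
  let ?B = "four_block_mat ?D ?U ?V (1\<^sub>m 1)"
  let ?L = "four_block_mat (1\<^sub>m n) (0\<^sub>m n 1) (- ?V) (1\<^sub>m 1)"
  let ?T = "four_block_mat (1\<^sub>m n) ?W (0\<^sub>m 1 n) (1\<^sub>m 1)"
  have B: "?B \<in> carrier_mat (n + 1) (n + 1)" and L: "?L \<in> carrier_mat (n + 1) (n + 1)"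
    and T: "?T \<in> carrier_mat (n + 1) (n + 1)"
    by (intro four_block_carrier_mat; simp)+
  have "?B * ?L = four_block_mat ?E ?U (0\<^sub>m 1 n) (1\<^sub>m 1)"
    by (subst mult_four_block_mat[of _ n n _ 1 _ 1 _ _ n _ 1])
       (auto intro!: cong_four_block_mat eq_matI simp: mat_diag_def scalar_prod_def)
  moreover have "Determinant.det ?L = 1"
    by (subst det_four_block_mat_upper_right_zero[of _ n _ 1]) auto
  ultimately have "Determinant.det ?B = Determinant.det ?E"
    using det_mult[OF B L] det_four_block_mat_lower_left_zero[of ?E n ?U 1 "0\<^sub>m 1 n" "1\<^sub>m 1"]
    by simp
  moreover have "?B * ?T = four_block_mat ?D (0\<^sub>m n 1) ?V ?s"
  proof -
    have "?B * ?T = four_block_mat (?D * 1\<^sub>m n + ?U * 0\<^sub>m 1 n) (?D * ?W + ?U * 1\<^sub>m 1)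
        (?V * 1\<^sub>m n + 1\<^sub>m 1 * 0\<^sub>m 1 n) (?V * ?W + 1\<^sub>m 1 * 1\<^sub>m 1)"
      by (rule mult_four_block_mat[of _ n n _ 1 _ 1 _ _ n _ 1]) auto
    also have "\<dots> = four_block_mat ?D (0\<^sub>m n 1) ?V ?s"
    proof (rule cong_four_block_mat)
      show "?D * ?W + ?U * 1\<^sub>m 1 = 0\<^sub>m n 1"
        by (subst mat_diag_mult_left[of _ n 1]) (auto intro!: eq_matI simp: f)
      show "?V * ?W + 1\<^sub>m 1 * 1\<^sub>m 1 = ?s"
        by (auto intro!: eq_matI simp: scalar_prod_def sum_negf lessThan_atLeast0 mult.commute)
    qed (auto intro!: eq_matI simp: mat_diag_def)
    finally show ?thesis .
  qed
  moreover have "Determinant.det ?T = 1"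
    by (subst det_four_block_mat_lower_left_zero[of _ n _ 1]) auto
  moreover have "Determinant.det ?D = (\<Prod>i<n. f i)"
    by (subst det_upper_triangular[of _ n])
       (auto simp: mat_diag_def upper_triangular_def diag_mat_def prod.list_conv_set_nth lessThan_atLeast0)
  moreover have "Determinant.det ?s = 1 - (\<Sum>i<n. u i * v i / f i)"
    by (subst det_single) auto
  ultimately show ?thesis
    using det_mult[OF B T] det_four_block_mat_upper_right_zero[of ?D n "0\<^sub>m n 1" 1 ?V ?s]
    by simp
qed

text \<open>The matrix whose determinant is taken is diag (s + c) minus b b^T. Evaluating at points
  \<open>s\<close> away from the poles \<open>- c i\<close> keeps the identity inside the
  field.\<close>

lemma poly_char_poly_rank_one_minus_diag:
  fixes b c :: "nat \<Rightarrow> 'a :: field"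
  assumes s: "\<And>i. i < n \<Longrightarrow> s + c i \<noteq> 0"
  shows "poly (char_poly (Matrix.mat n n (\<lambda>(i, j). b i * b j - (if i = j then c i else 0)))) s
    = (\<Prod>i<n. s + c i) * (1 - (\<Sum>i<n. (b i)\<^sup>2 / (s + c i)))"
proof -
  let ?A = "Matrix.mat n n (\<lambda>(i, j). b i * b j - (if i = j then c i else 0))"
  have "- char_matrix ?A s = Matrix.mat n n (\<lambda>(i, j). (if i = j then s + c i else 0) - b i * b j)"
    by (auto intro!: eq_matI simp: char_matrix_def)
  then show ?thesis
    using det_diag_minus_rank_one[of n "\<lambda>i. s + c i" b b] s
    by (simp add: char_poly_matrix[of _ n] power2_eq_square)
qed

lemma mat_adjoint_index [simp]:
  "i < dim_col A \<Longrightarrow> j < dim_row A \<Longrightarrow> mat_adjoint A $$ (i, j) = conjugate (A $$ (j, i))"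
  by (simp add: mat_adjoint_def mat_of_rows_def)

lemma mat_adjoint_dim [simp]: "dim_row (mat_adjoint A) = dim_col A" "dim_col (mat_adjoint A) = dim_row A"
  by (auto simp: mat_adjoint_def)

text \<open>The i-th entry of the path-loss matrix times the gain vector normalised to unit total
  power: the vector b in R = b b^T - diag c.\<close>

definition channel_coeff :: "nat \<Rightarrow> real \<Rightarrow> (nat \<Rightarrow> real) \<Rightarrow> real \<Rightarrow> (nat \<Rightarrow> real) \<Rightarrow> nat \<Rightarrow> real" where
  "channel_coeff N v\<theta> vv \<gamma> d i = d i powr (- \<gamma>) / sqrt (real N * (v\<theta> + vv i))"

lemma equal_gain_channel:
  assumes "i < N"
  shows "equal_gain N PT v\<theta> vv $$ (i, 0) * channel \<gamma> d z i
    = of_real (sqrt PT * channel_coeff N v\<theta> vv \<gamma> d i) * z i"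
proof -
  have "sqrt (PT / N) * (1 / sqrt (v\<theta> + vv i)) / d i powr \<gamma> = sqrt PT * channel_coeff N v\<theta> vv \<gamma> d i"
    by (simp add: channel_coeff_def real_sqrt_divide real_sqrt_mult real_sqrt_inverse powr_minus divide_inverse mult_ac)
  then have "complex_of_real (sqrt (PT / N) * (1 / sqrt (v\<theta> + vv i)) / d i powr \<gamma>) * z i
      = of_real (sqrt PT * channel_coeff N v\<theta> vv \<gamma> d i) * z i"
    by simp
  then show ?thesis
    using assms by (simp add: equal_gain_def col_vec_def channel_def)
qed

lemma cnj_equal_gain:
  "i < N \<Longrightarrow> cnj (equal_gain N PT v\<theta> vv $$ (i, 0)) = equal_gain N PT v\<theta> vv $$ (i, 0)"
  by (simp add: equal_gain_def col_vec_def)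

lemma col_mat_times_row_mat_index:
  assumes "A \<in> carrier_mat n 1" "B \<in> carrier_mat 1 m" "i < n" "j < m"
  shows "(A * B) $$ (i, j) = A $$ (i, 0) * B $$ (0, j)"
  using assms by (simp add: scalar_prod_def)

text \<open>The product reassociates into the 1 x 1 matrices a^H h and h^H a. Since the gains are
  real, these are conjugates of each other, and their product is a squared modulus.\<close>

lemma signal_power_equal_gain:
  assumes "0 \<le> PT"
  shows "signal_power N (equal_gain N PT v\<theta> vv) (channel \<gamma> d z)
    = PT * (cmod (\<Sum>i<N. of_real (channel_coeff N v\<theta> vv \<gamma> d i) * z i))\<^sup>2"
proof -
  let ?a = "equal_gain N PT v\<theta> vv" and ?h = "col_vec N (channel \<gamma> d z)"
  let ?X = "\<Sum>i<N. of_real (channel_coeff N v\<theta> vv \<gamma> d i) * z i"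
  have ac: "?a \<in> carrier_mat N 1" "?h \<in> carrier_mat N 1"
    by (auto simp: equal_gain_def col_vec_def)
  have ad: "mat_adjoint ?a \<in> carrier_mat 1 N" "mat_adjoint ?h \<in> carrier_mat 1 N"
    using ac by auto
  have dims: "dim_row ?a = N" "dim_col ?a = 1" using ac by auto
  have h: "dim_row ?h = N" "dim_col ?h = 1" by (auto simp: col_vec_def)
  have h_i: "?h $$ (i, 0) = channel \<gamma> d z i" if "i < N" for i
    using that by (simp add: col_vec_def)
  have "(mat_adjoint ?a * ?h) $$ (0, 0) = (\<Sum>i<N. ?a $$ (i, 0) * channel \<gamma> d z i)"
    by (simp add: scalar_prod_def lessThan_atLeast0 dims h h_i cnj_equal_gain)
  also have "\<dots> = of_real (sqrt PT) * ?X"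
    by (simp add: equal_gain_channel sum_distrib_left mult.assoc)
  finally have 1: "(mat_adjoint ?a * ?h) $$ (0, 0) = of_real (sqrt PT) * ?X" .
  have "(mat_adjoint ?h * ?a) $$ (0, 0) = (\<Sum>i<N. cnj (?a $$ (i, 0) * channel \<gamma> d z i))"
    by (simp add: scalar_prod_def lessThan_atLeast0 dims h h_i cnj_equal_gain mult.commute)
  also have "\<dots> = cnj (of_real (sqrt PT) * ?X)"
    by (simp add: equal_gain_channel sum_distrib_left mult.assoc)
  finally have 2: "(mat_adjoint ?h * ?a) $$ (0, 0) = cnj (of_real (sqrt PT) * ?X)" .
  have "mat_adjoint ?a * ?h * mat_adjoint ?h * ?a = (mat_adjoint ?a * ?h) * (mat_adjoint ?h * ?a)"
    using ac ad by (intro assoc_mult_mat[of _ 1 1 _ N _ 1]) auto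
  moreover have "(\<dots>) $$ (0, 0) = (mat_adjoint ?a * ?h) $$ (0, 0) * (mat_adjoint ?h * ?a) $$ (0, 0)"
    using ac ad by (intro col_mat_times_row_mat_index) auto
  ultimately have "signal_power N ?a (channel \<gamma> d z) = (cmod (of_real (sqrt PT) * ?X))\<^sup>2"
    unfolding signal_power_def 1 2 by (simp only: complex_norm_square[symmetric] Re_complex_of_real)
  then show ?thesis
    using assms by (simp add: norm_mult power_mult_distrib)
qed

lemma obs_noise_power_equal_gain:
  assumes "0 \<le> PT"
  shows "obs_noise_power N vv (equal_gain N PT v\<theta> vv) (channel \<gamma> d z)
    = PT * (\<Sum>i<N. vv i * (channel_coeff N v\<theta> vv \<gamma> d i)\<^sup>2 * (cmod (z i))\<^sup>2)"
proof -
  let ?a = "equal_gain N PT v\<theta> vv" and ?h = "channel \<gamma> d z"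
  let ?H = "mat_diag N ?h"
  have ac: "?a \<in> carrier_mat N 1" by (auto simp: equal_gain_def col_vec_def)
  have ad: "mat_adjoint ?a \<in> carrier_mat 1 N" using ac by auto
  have H: "mat_adjoint ?H = mat_diag N (\<lambda>i. cnj (?h i))"
    by (auto intro!: eq_matI simp: mat_diag_def)
  \<comment> \<open>The three diagonal factors collapse into one, with entries
    \<open>vv i * (cmod (?h i))\<^sup>2\<close>.\<close>
  have "mat_adjoint ?a * ?H * mat_diag N (\<lambda>i. of_real (vv i)) * mat_adjoint ?H * ?a
      = mat_adjoint ?a * mat_diag N (\<lambda>i. of_real (vv i * (cmod (?h i))\<^sup>2)) * ?a"
    unfolding H using ad
    by (simp add: assoc_mult_mat[of _ 1 N _ N _ N] complex_norm_square mult_ac del: of_real_power)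
  moreover have "(mat_adjoint ?a * mat_diag N (\<lambda>i. of_real (vv i * (cmod (?h i))\<^sup>2)) * ?a) $$ (0, 0)
      = (\<Sum>i<N. of_real (vv i * (cmod (?a $$ (i, 0) * ?h i))\<^sup>2))"
  proof -
    have "cnj (?a $$ (i, 0)) * of_real (vv i * (cmod (?h i))\<^sup>2) * ?a $$ (i, 0)
        = of_real (vv i * (cmod (?a $$ (i, 0) * ?h i))\<^sup>2)" for i
      by (simp add: norm_mult power_mult_distrib complex_norm_square del: of_real_power)
    then show ?thesis
      using ac ad by (simp add: mat_diag_mult_right[of _ 1 N] scalar_prod_def lessThan_atLeast0
          del: of_real_mult of_real_power)
  qed
  ultimately have "obs_noise_power N vv ?a ?h = (\<Sum>i<N. vv i * (cmod (?a $$ (i, 0) * ?h i))\<^sup>2)"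
    by (simp only: obs_noise_power_def Let_def Re_sum Re_complex_of_real)
  also have "\<dots> = (\<Sum>i<N. PT * (vv i * (channel_coeff N v\<theta> vv \<gamma> d i)\<^sup>2 * (cmod (z i))\<^sup>2))"
    using assms by (intro sum.cong) (auto simp: equal_gain_channel norm_mult power_mult_distrib)
  finally show ?thesis by (simp add: sum_distrib_left)
qed

text \<open>The link between spectrum and channel: the coefficients here are those of the signal and
  noise powers, so \<open>R_mat\<close> is the matrix of the quadratic form that decides the
  outage.\<close>

lemma R_mat_rank_one_minus_diag:
  fixes d :: "nat \<Rightarrow> real" and \<gamma> :: real
  assumes "0 < PT" and "\<And>i. i < N \<Longrightarrow> 0 < v\<theta> + vv i"
  defines "b \<equiv> channel_coeff N v\<theta> vv \<gamma> d"
  shows "R_mat N PT v\<theta> vv \<gamma> d P \<epsilon> = Matrix.mat N N (\<lambda>(i, j). of_real (b i) * of_real (b j)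
    - (if i = j then of_real ((P - \<epsilon>) / (\<epsilon> * P) * vv i * (b i)\<^sup>2) else 0))"
proof -
  let ?M = "loss_mat N \<gamma> d"
  define u where "u = complex_of_real (1 / sqrt PT) \<cdot>\<^sub>m equal_gain N PT v\<theta> vv"
  have u: "u \<in> carrier_mat N 1" "mat_adjoint u \<in> carrier_mat 1 N"
    by (auto simp: u_def equal_gain_def col_vec_def)
  have u_i: "u $$ (i, 0) = of_real (1 / sqrt (real N * (v\<theta> + vv i)))" if "i < N" for i
    using that \<open>0 < PT\<close> by (simp add: u_def equal_gain_def col_vec_def real_sqrt_divide real_sqrt_mult)
  have Mu: "(?M * u) $$ (i, 0) = of_real (b i)" if "i < N" for i
    using that u by (simp add: loss_mat_def mat_diag_mult_left[of _ N 1] u_i b_def channel_coeff_def)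
  have uM: "(mat_adjoint u * ?M) $$ (0, i) = of_real (b i)" if "i < N" for i
    using that u by (simp add: loss_mat_def mat_diag_mult_right[of _ 1 N] u_i b_def channel_coeff_def)
  have M: "?M \<in> carrier_mat N N" by (simp add: loss_mat_def)
  have "?M * u * mat_adjoint u * ?M = (?M * u) * (mat_adjoint u * ?M)"
    using u M by (intro assoc_mult_mat[of _ N 1 _ N _ N]) auto
  also have "\<dots> = Matrix.mat N N (\<lambda>(i, j). of_real (b i) * of_real (b j))"
  proof (intro eq_matI, goal_cases)
    case (1 i j)
    then show ?case
      using u M col_mat_times_row_mat_index[of "?M * u" N "mat_adjoint u * ?M" N i j]
      by (simp add: Mu uM del: index_mult_mat(1))
  qed (use u M in auto)
  finally have 1: "?M * u * mat_adjoint u * ?M = Matrix.mat N N (\<lambda>(i, j). of_real (b i) * of_real (b j))" .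
  have 2: "vv i / (real N * (v\<theta> + vv i) * d i powr (2 * \<gamma>)) = vv i * (b i)\<^sup>2" if "i < N" for i
  proof -
    have "d i powr (2 * \<gamma>) = (d i powr \<gamma>)\<^sup>2"
      using powr_add[of "d i" \<gamma> \<gamma>] by (simp add: power2_eq_square)
    moreover have "(sqrt (real N * (v\<theta> + vv i)))\<^sup>2 = real N * (v\<theta> + vv i)"
      using assms(2)[OF that] by (intro real_sqrt_pow2) simp
    ultimately show ?thesis
      by (simp add: b_def channel_coeff_def power_divide powr_minus power_inverse power_mult_distrib divide_inverse mult_ac del: real_sqrt_mult)
  qed
  have 3: "complex_of_real ((P - \<epsilon>) / (\<epsilon> * P))
        * of_real (vv i / (real N * (v\<theta> + vv i) * d i powr (2 * \<gamma>)))
      = of_real ((P - \<epsilon>) / (\<epsilon> * P) * vv i * (b i)\<^sup>2)" if "i < N" for i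
    unfolding of_real_mult[symmetric] 2[OF that] by (simp only: mult.assoc)
  show ?thesis
    unfolding R_mat_def Let_def u_def[symmetric] 1
    by (intro eq_matI) (auto simp: Q_mat_def mat_diag_def 3
        simp del: of_real_mult of_real_divide of_real_diff of_real_add of_real_power)
qed

section \<open>Sums of weighted exponentials, equality of laws, and the sign of the
  eigenvalues\<close>

section \<open>Reduction to exponential variables\<close>

lemma prob_space_exponential_one: "prob_space (density lborel (exponential_density 1))"
  by (rule prob_space_exponential_density) simp

text \<open>Exponential tilting: the weight \<open>exp (\<theta> * x)\<close> turns the density of
  rate 1 into \<open>1 / (1 - \<theta>)\<close> times the density of rate
  \<open>1 - \<theta>\<close>.\<close>

lemma nn_integral_exponential_exp:
  fixes \<theta> :: real
  assumes "\<theta> < 1"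
  shows "(\<integral>\<^sup>+x. ennreal (exp (\<theta> * x)) \<partial>density lborel (exponential_density 1)) = ennreal (1 / (1 - \<theta>))"
proof -
  interpret E: prob_space "density lborel (exponential_density (1 - \<theta>))"
    using assms by (intro prob_space_exponential_density) simp
  have "exponential_density 1 x * exp (\<theta> * x) = 1 / (1 - \<theta>) * exponential_density (1 - \<theta>) x" for x
    using assms by (simp add: exponential_density_def mult_exp_exp) (simp add: algebra_simps)
  then have "(\<integral>\<^sup>+x. ennreal (exp (\<theta> * x)) \<partial>density lborel (exponential_density 1))
      = (\<integral>\<^sup>+x. ennreal (1 / (1 - \<theta>) * exponential_density (1 - \<theta>) x) \<partial>lborel)"
    by (simp add: nn_integral_density ennreal_mult'[symmetric] exponential_density_nonneg)
  also have "\<dots> = (\<integral>\<^sup>+x. ennreal (1 / (1 - \<theta>)) * ennreal (exponential_density (1 - \<theta>) x) \<partial>lborel)"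
    using assms by (intro nn_integral_cong ennreal_mult) (auto simp: exponential_density_nonneg)
  also have "\<dots> = ennreal (1 / (1 - \<theta>)) * (\<integral>\<^sup>+x. ennreal (exponential_density (1 - \<theta>) x) \<partial>lborel)"
    by (rule nn_integral_cmult) simp
  also have "(\<integral>\<^sup>+x. ennreal (exponential_density (1 - \<theta>) x) \<partial>lborel) = 1"
    using E.emeasure_space_1 by (simp add: emeasure_density)
  finally show ?thesis by simp
qed

lemma nn_integral_PiM_exponential_exp_linear:
  fixes lam :: "'i \<Rightarrow> real" and \<theta> :: real
  assumes "finite I" and "\<And>i. i \<in> I \<Longrightarrow> \<theta> * lam i < 1"
  shows "(\<integral>\<^sup>+x. ennreal (exp (\<theta> * (\<Sum>i\<in>I. lam i * x i))) \<partial>PiM I (\<lambda>_. density lborel (exponential_density 1)))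
    = ennreal (1 / (\<Prod>i\<in>I. 1 - \<theta> * lam i))"
proof -
  interpret product_sigma_finite "\<lambda>_. density lborel (exponential_density 1)"
    by (intro product_sigma_finite.intro prob_space_imp_sigma_finite prob_space_exponential_one)
  have "ennreal (exp (\<theta> * (\<Sum>i\<in>I. lam i * x i))) = (\<Prod>i\<in>I. ennreal (exp (\<theta> * lam i * x i)))" for x
    using \<open>finite I\<close> by (simp add: sum_distrib_left exp_sum prod_ennreal mult.assoc)
  then have "(\<integral>\<^sup>+x. ennreal (exp (\<theta> * (\<Sum>i\<in>I. lam i * x i))) \<partial>PiM I (\<lambda>_. density lborel (exponential_density 1)))
      = (\<Prod>i\<in>I. \<integral>\<^sup>+x. ennreal (exp (\<theta> * lam i * x)) \<partial>density lborel (exponential_density 1))"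
    using \<open>finite I\<close> by (simp only:) (rule product_nn_integral_prod; simp)
  also have "\<dots> = (\<Prod>i\<in>I. ennreal (1 / (1 - \<theta> * lam i)))"
    using assms(2) by (intro prod.cong nn_integral_exponential_exp) auto
  also have "\<dots> = ennreal (\<Prod>i\<in>I. 1 / (1 - \<theta> * lam i))"
    using assms(2) by (intro prod_ennreal) (simp add: less_imp_le)
  finally show ?thesis by (simp add: prod_dividef)
qed

lemma emeasure_exponential_atLeast:
  assumes "0 \<le> r"
  shows "emeasure (density lborel (exponential_density 1)) {r..} = ennreal (exp (- r))"
proof -
  have "((\<lambda>x::real. - exp (- x)) \<longlongrightarrow> 0) at_top" by real_asymp
  then have "(\<integral>\<^sup>+x. ennreal (exp (- x)) * indicator {r..} x \<partial>lborel) = ennreal (0 - - exp (- r))"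
    by (intro nn_integral_FTC_atLeast) (auto intro!: derivative_eq_intros)
  moreover have "emeasure (density lborel (exponential_density 1)) {r..}
      = (\<integral>\<^sup>+x. ennreal (exp (- x)) * indicator {r..} x \<partial>lborel)"
    using assms by (auto simp: emeasure_density exponential_density_def intro!: nn_integral_cong split: split_indicator)
  ultimately show ?thesis by simp
qed

lemma AE_PiM_exponential_nonneg:
  assumes "finite I"
  shows "AE x in PiM I (\<lambda>_. density lborel (exponential_density 1)). \<forall>i\<in>I. 0 \<le> x i"
proof (rule AE_finite_allI[OF assms])
  fix i assume "i \<in> I"
  moreover have "AE x in density lborel (exponential_density 1). 0 \<le> x"
    by (auto simp: AE_density exponential_density_def)
  ultimately show "AE x in PiM I (\<lambda>_. density lborel (exponential_density 1)). 0 \<le> x i"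
    by (intro AE_PiM_component[where M = "\<lambda>_. density lborel (exponential_density 1)"] prob_space_exponential_one)
qed

text \<open>Condition on the variables in \<open>I\<close>. Their contribution is at most 0, so the
  threshold left for the k-th variable is nonnegative and its tail is a pure exponential. What
  remains is the moment generating function of the other sum at \<open>1 / lam k\<close>, finite
  because those weights are nonpositive.\<close>

lemma emeasure_PiM_exponential_linear_ge:
  fixes lam :: "'i \<Rightarrow> real"
  assumes "finite I" "k \<notin> I" "0 < lam k" "\<And>l. l \<in> I \<Longrightarrow> lam l \<le> 0" "0 \<le> t"
  defines "M \<equiv> PiM (insert k I) (\<lambda>_. density lborel (exponential_density 1))"
  shows "emeasure M {x \<in> space M. t \<le> (\<Sum>l\<in>insert k I. lam l * x l)}
    = ennreal (exp (- t / lam k) / (\<Prod>l\<in>I. 1 - lam l / lam k))"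
proof -
  let ?E = "density lborel (exponential_density 1)"
  interpret product_sigma_finite "\<lambda>_. ?E"
    by (intro product_sigma_finite.intro prob_space_imp_sigma_finite prob_space_exponential_one)
  let ?f = "\<lambda>x. indicator {t..} (\<Sum>l\<in>insert k I. lam l * x l) :: ennreal"
  have "emeasure M {x \<in> space M. t \<le> (\<Sum>l\<in>insert k I. lam l * x l)} = (\<integral>\<^sup>+x. ?f x \<partial>M)"
  proof -
    have "{x \<in> space M. t \<le> (\<Sum>l\<in>insert k I. lam l * x l)} \<in> sets M"
      unfolding M_def by measurable
    then have "emeasure M {x \<in> space M. t \<le> (\<Sum>l\<in>insert k I. lam l * x l)}
        = (\<integral>\<^sup>+x. indicator {x \<in> space M. t \<le> (\<Sum>l\<in>insert k I. lam l * x l)} x \<partial>M)"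
      by (rule nn_integral_indicator[symmetric])
    also have "\<dots> = (\<integral>\<^sup>+x. ?f x \<partial>M)"
      by (intro nn_integral_cong) (simp split: split_indicator)
    finally show ?thesis .
  qed
  also have "\<dots> = (\<integral>\<^sup>+x. \<integral>\<^sup>+y. ?f (x(k := y)) \<partial>?E \<partial>PiM I (\<lambda>_. ?E))"
    unfolding M_def using assms(1,2) by (intro product_nn_integral_insert) measurable
  also have "\<dots> = (\<integral>\<^sup>+x. ennreal (exp (- t / lam k)) * ennreal (exp (1 / lam k * (\<Sum>l\<in>I. lam l * x l))) \<partial>PiM I (\<lambda>_. ?E))"
  proof (rule nn_integral_cong_AE)
    show "AE x in PiM I (\<lambda>_. ?E). (\<integral>\<^sup>+y. ?f (x(k := y)) \<partial>?E) =
        ennreal (exp (- t / lam k)) * ennreal (exp (1 / lam k * (\<Sum>l\<in>I. lam l * x l)))"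
      using AE_PiM_exponential_nonneg[OF assms(1)]
    proof eventually_elim
      case (elim x)
      \<comment> \<open>The value the k-th variable must reach. Its sign matters: below 0 the tail
        would be 1 and not \<open>exp (- r)\<close>.\<close>
      define r where "r = (t - (\<Sum>l\<in>I. lam l * x l)) / lam k"
      have "(\<Sum>l\<in>I. lam l * x l) \<le> 0"
        using elim assms(4) by (intro sum_nonpos mult_nonpos_nonneg) auto
      then have r: "0 \<le> r" using assms(3,5) by (simp add: r_def)
      have "(\<Sum>l\<in>I. lam l * (x(k := y)) l) = (\<Sum>l\<in>I. lam l * x l)" for y
        using assms(2) by (intro sum.cong) auto
      then have "?f (x(k := y)) = indicator {r..} y" for y
        using assms(1-3) by (auto simp: r_def field_simps split: split_indicator)
      then have "(\<integral>\<^sup>+y. ?f (x(k := y)) \<partial>?E) = ennreal (exp (- r))"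
        using emeasure_exponential_atLeast[OF r] by simp
      also have "exp (- r) = exp (- t / lam k) * exp (1 / lam k * (\<Sum>l\<in>I. lam l * x l))"
        by (simp add: r_def mult_exp_exp diff_divide_distrib)
      finally show ?case by (simp add: ennreal_mult)
    qed
  qed
  also have "\<dots> = ennreal (exp (- t / lam k)) * ennreal (1 / (\<Prod>l\<in>I. 1 - 1 / lam k * lam l))"
    using assms(3,4)
    by (subst nn_integral_cmult, simp, subst nn_integral_PiM_exponential_exp_linear[OF assms(1)])
       (auto simp: divide_nonpos_pos intro: le_less_trans[of _ 0])
  also have "\<dots> = ennreal (exp (- t / lam k) / (\<Prod>l\<in>I. 1 - lam l / lam k))"
  proof -
    have "0 \<le> 1 - lam l / lam k" if "l \<in> I" for l
      using assms(3) assms(4)[OF that] divide_nonpos_pos[of "lam l" "lam k"] by simp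
    then have "0 \<le> (\<Prod>l\<in>I. 1 - lam l / lam k)" by (rule prod_nonneg)
    then show ?thesis by (simp add: ennreal_mult[symmetric])
  qed
  finally show ?thesis .
qed

text \<open>The Gaussian formula with coefficient \<open>\<theta>\<close>, weights
  \<open>\<theta> * c i\<close> and offset 0 gives the moment generating function of the form; the
  secular identity at \<open>1 / \<theta>\<close> turns it into that of the exponential sum.\<close>

lemma distr_rank_one_minus_diag_form:
  fixes b c lam :: "nat \<Rightarrow> real"
  assumes secular: "\<And>s. (\<And>i. i < N \<Longrightarrow> s + c i \<noteq> 0) \<Longrightarrow>
      (\<Prod>i<N. s + c i) * (1 - (\<Sum>i<N. (b i)\<^sup>2 / (s + c i))) = (\<Prod>l<N. s - lam l)"
  shows "distr (PiM {..<N} (\<lambda>_. complex_normal)) borel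
        (\<lambda>z. (cmod (\<Sum>i<N. of_real (b i) * z i))\<^sup>2 - (\<Sum>i<N. c i * (cmod (z i))\<^sup>2))
    = distr (PiM {..<N} (\<lambda>_. density lborel (exponential_density 1))) borel (\<lambda>x. \<Sum>l<N. lam l * x l)"
    (is "distr ?Z borel ?X = distr ?E borel ?Y")
proof -
  interpret Z: product_prob_space "\<lambda>_. complex_normal" "{..<N}"
    by (intro product_prob_spaceI prob_space_complex_normal)
  interpret E: product_prob_space "\<lambda>_. density lborel (exponential_density 1)" "{..<N}"
    by (intro product_prob_spaceI prob_space_exponential_one)
  have X [measurable]: "?X \<in> borel_measurable ?Z" by measurable
  have Y [measurable]: "?Y \<in> borel_measurable ?E" by measurable
  let ?G = "\<lambda>\<theta>. 1 - \<theta> * (\<Sum>i<N. (b i)\<^sup>2 / (1 + \<theta> * c i))"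
  \<comment> \<open>All positivity conditions under which the two integrals were computed are strict
    and hold at 0, hence near 0 by continuity.\<close>
  have "\<forall>\<^sub>F \<theta> in nhds 0. (\<forall>i<N. 0 < 1 + \<theta> * c i) \<and> (\<forall>l<N. \<theta> * lam l < 1) \<and> 0 < ?G \<theta>"
  proof (intro eventually_conj)
    have "\<forall>\<^sub>F \<theta> in nhds 0. \<forall>i\<in>{..<N}. 0 < 1 + \<theta> * c i"
      by (intro eventually_ball_finite ballI finite_lessThan order_tendstoD(1)[where y = "1 + 0 * c _"] tendsto_intros filterlim_ident)
         auto
    then show "\<forall>\<^sub>F \<theta> in nhds 0. \<forall>i<N. 0 < 1 + \<theta> * c i"
      by (simp only: Ball_def lessThan_iff)
    have "\<forall>\<^sub>F \<theta> in nhds 0. \<forall>i\<in>{..<N}. \<theta> * lam i < 1"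
      by (intro eventually_ball_finite ballI finite_lessThan order_tendstoD(2)[where y = "0 * lam _"] tendsto_intros filterlim_ident)
         auto
    then show "\<forall>\<^sub>F \<theta> in nhds 0. \<forall>l<N. \<theta> * lam l < 1"
      by (simp only: Ball_def lessThan_iff)
    have "(?G \<longlongrightarrow> ?G 0) (nhds 0)"
      by (intro tendsto_intros filterlim_ident) auto
    then show "\<forall>\<^sub>F \<theta> in nhds 0. 0 < ?G \<theta>"
      by (rule order_tendstoD(1)) simp
  qed
  then obtain \<delta> where "\<delta> > 0" and \<delta>: "\<And>\<theta>. \<bar>\<theta>\<bar> < \<delta> \<Longrightarrow>
      (\<forall>i<N. 0 < 1 + \<theta> * c i) \<and> (\<forall>l<N. \<theta> * lam l < 1) \<and> 0 < ?G \<theta>"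
    unfolding eventually_nhds_metric by auto
  have mgf_X: "(\<integral>\<^sup>+x. ennreal (exp (\<theta> * x)) \<partial>distr ?Z borel ?X)
      = ennreal (1 / ((\<Prod>i<N. 1 + \<theta> * c i) * ?G \<theta>))" if "\<bar>\<theta>\<bar> < \<delta>" for \<theta>
  proof -
    have "(\<integral>\<^sup>+x. ennreal (exp (\<theta> * x)) \<partial>distr ?Z borel ?X) =
        (\<integral>\<^sup>+z. ennreal (exp (\<theta> * (cmod ((\<Sum>i<N. of_real (b i) * z i) + 0))\<^sup>2 - (\<Sum>i<N. (\<theta> * c i) * (cmod (z i))\<^sup>2))) \<partial>?Z)"
      by (subst nn_integral_distr) (auto simp: algebra_simps sum_distrib_left)
    also have "\<dots> = ennreal (1 / ((\<Prod>i<N. 1 + \<theta> * c i) * ?G \<theta>))"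
      using \<delta>[OF that] by (subst nn_integral_PiM_complex_normal_exp_rank_one) auto
    finally show ?thesis .
  qed
  have mgf_Y: "(\<integral>\<^sup>+x. ennreal (exp (\<theta> * x)) \<partial>distr ?E borel ?Y) = ennreal (1 / (\<Prod>l<N. 1 - \<theta> * lam l))"
    if "\<bar>\<theta>\<bar> < \<delta>" for \<theta>
    using \<delta>[OF that] by (subst nn_integral_distr) (auto intro!: nn_integral_PiM_exponential_exp_linear)
  have mgf_eq: "(\<Prod>i<N. 1 + \<theta> * c i) * ?G \<theta> = (\<Prod>l<N. 1 - \<theta> * lam l)" if "\<bar>\<theta>\<bar> < \<delta>" for \<theta>
  proof (cases "\<theta> = 0")
    case False
    \<comment> \<open>Taking \<open>\<theta>\<close> out of each of the \<open>N\<close> factors on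
      both sides reduces the claim to the secular identity; at 0 both sides are 1.\<close>
    have scale: "1 + \<theta> * c i = \<theta> * (1 / \<theta> + c i)" "1 - \<theta> * lam i = \<theta> * (1 / \<theta> - lam i)" for i
      using False by (simp_all add: algebra_simps)
    have "1 / \<theta> + c i \<noteq> 0" if "i < N" for i
      using \<delta>[OF \<open>\<bar>\<theta>\<bar> < \<delta>\<close>] that scale(1)[of i] by fastforce
    note secular[of "1 / \<theta>", OF this]
    moreover have "?G \<theta> = 1 - (\<Sum>i<N. (b i)\<^sup>2 / (1 / \<theta> + c i))"
      using False by (simp add: scale(1) sum_distrib_left)
    ultimately show ?thesis
      by (simp add: scale prod.distrib)
  qed simp
  show ?thesis
  proof (rule real_distribution_eqI_mgf[OF _ _ \<open>\<delta> > 0\<close>])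
    show "real_distribution (distr ?Z borel ?X)" "real_distribution (distr ?E borel ?Y)"
      by (intro Z.real_distribution_distr X, intro E.real_distribution_distr Y)
  qed (simp_all add: mgf_X mgf_Y mgf_eq)
qed

text \<open>Divide the secular identity by \<open>s - lam k\<close>. The product over the other
  eigenvalues becomes a sum that is strictly positive for every \<open>s > 0\<close>, so none of
  them can be positive.\<close>

lemma eigenvalue_nonpos_of_secular:
  fixes b c lam :: "nat \<Rightarrow> real"
  assumes secular: "\<And>s. (\<And>i. i < N \<Longrightarrow> s + c i \<noteq> 0) \<Longrightarrow>
      (\<Prod>i<N. s + c i) * (1 - (\<Sum>i<N. (b i)\<^sup>2 / (s + c i))) = (\<Prod>l<N. s - lam l)"
    and c: "\<And>i. i < N \<Longrightarrow> 0 < c i" and b: "\<And>i. i < N \<Longrightarrow> b i \<noteq> 0"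
    and "k < N" "l < N" "l \<noteq> k" "0 < lam k"
  shows "lam l \<le> 0"
proof (rule ccontr)
  assume "\<not> lam l \<le> 0"
  let ?g = "\<lambda>s. \<Sum>i<N. (b i)\<^sup>2 / (s + c i)"
  let ?Q = "\<lambda>s. \<Prod>j\<in>{..<N} - {k}. s - lam j"
  \<comment> \<open>The divided difference of the secular function at \<open>s\<close> and
    \<open>lam k\<close>, where that function vanishes, times the common product.\<close>
  let ?H = "\<lambda>s. (\<Prod>i<N. s + c i) * (\<Sum>i<N. (b i)\<^sup>2 / ((s + c i) * (lam k + c i)))"
  have split: "(\<Prod>l<N. s - lam l) = (s - lam k) * ?Q s" for s
    using \<open>k < N\<close> by (simp add: prod.remove[of "{..<N}" k])
  have pos: "0 < s + c i" if "0 < s" "i < N" for s i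
    using that c[of i] by simp
  have sec: "(\<Prod>i<N. s + c i) * (1 - ?g s) = (s - lam k) * ?Q s" if "0 < s" for s
    using secular[of s] pos[OF that] split by force
  have ppos: "0 < (\<Prod>i<N. s + c i)" if "0 < s" for s
    using pos[OF that] by (intro prod_pos) auto
  have g1: "?g (lam k) = 1"
    using sec[OF \<open>0 < lam k\<close>] ppos[OF \<open>0 < lam k\<close>, THEN less_imp_neq, symmetric]
    by (simp del: prod_zero_iff)
  have QH: "?Q s = ?H s" if "0 < s" "s \<noteq> lam k" for s
  proof -
    have "1 - ?g s = ?g (lam k) - ?g s" using g1 by simp
    also have "\<dots> = (\<Sum>i<N. (s - lam k) * ((b i)\<^sup>2 / ((s + c i) * (lam k + c i))))"
      unfolding sum_subtractf[symmetric]
    proof (rule sum.cong)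
      fix i assume "i \<in> {..<N}"
      then have "s + c i \<noteq> 0" "lam k + c i \<noteq> 0"
        using pos[of s i] pos[of "lam k" i] that(1) \<open>0 < lam k\<close> by auto
      then show "(b i)\<^sup>2 / (lam k + c i) - (b i)\<^sup>2 / (s + c i) = (s - lam k) * ((b i)\<^sup>2 / ((s + c i) * (lam k + c i)))"
        by (simp add: field_simps)
    qed simp
    also have "\<dots> = (s - lam k) * (\<Sum>i<N. (b i)\<^sup>2 / ((s + c i) * (lam k + c i)))"
      by (simp add: sum_distrib_left)
    finally show ?thesis using sec[OF that(1)] that(2) by simp
  qed
  \<comment> \<open>Division is impossible at \<open>lam k\<close> itself, so the identity is
    extended there by continuity. This excludes a repeated positive eigenvalue.\<close>
  have "(?Q \<longlongrightarrow> ?H (lam k)) (at (lam k))"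
  proof (rule Lim_transform_eventually)
    show "(?H \<longlongrightarrow> ?H (lam k)) (at (lam k))"
      using pos[OF \<open>0 < lam k\<close>] by (intro tendsto_intros) (auto simp: less_imp_neq[symmetric])
    have "\<forall>\<^sub>F s in at (lam k). 0 < s"
      using order_tendstoD(1)[OF tendsto_ident_at \<open>0 < lam k\<close>] .
    then show "\<forall>\<^sub>F s in at (lam k). ?H s = ?Q s"
      using eventually_neq_at_within[of "lam k" "lam k" UNIV] by eventually_elim (simp add: QH)
  qed
  moreover have "(?Q \<longlongrightarrow> ?Q (lam k)) (at (lam k))"
    by (intro tendsto_intros)
  ultimately have "?Q (lam k) = ?H (lam k)"
    by (rule tendsto_unique[OF trivial_limit_at, rotated])
  then have "?Q (lam l) = ?H (lam l)"
    using QH[of "lam l"] \<open>\<not> lam l \<le> 0\<close> by (cases "lam l = lam k") auto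
  moreover have "?Q (lam l) = 0"
    using \<open>l < N\<close> \<open>l \<noteq> k\<close> by (intro prod_zero) auto
  moreover have "0 < ?H (lam l)"
  proof (intro mult_pos_pos prod_pos sum_pos)
    show "0 < (b i)\<^sup>2 / ((lam l + c i) * (lam k + c i))" if "i \<in> {..<N}" for i
      using that b[of i] pos[of "lam l" i] pos[of "lam k" i] \<open>\<not> lam l \<le> 0\<close> \<open>0 < lam k\<close> by auto
  qed (use \<open>\<not> lam l \<le> 0\<close> \<open>k < N\<close> pos[of "lam l"] in auto)
  ultimately show False by (metis less_irrefl)
qed

section \<open>From the fading variables to the outage formula\<close>

section \<open>The outage probability\<close>

lemma distr_std_complex_normal:
  assumes "prob_space S" "std_complex_normal S Z"
  shows "distr S borel Z = complex_normal"
proof -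
  interpret prob_space S by fact
  let ?N = "density lborel (normal_density 0 (sqrt (1 / 2)))"
  have ind: "indep_var borel (\<lambda>\<omega>. Re (Z \<omega>)) borel (\<lambda>\<omega>. Im (Z \<omega>))"
    and re: "distributed S lborel (\<lambda>\<omega>. Re (Z \<omega>)) (normal_density 0 (sqrt (1 / 2)))"
    and im: "distributed S lborel (\<lambda>\<omega>. Im (Z \<omega>)) (normal_density 0 (sqrt (1 / 2)))"
    using assms(2) by (auto simp: std_complex_normal_def)
  have [measurable]: "(\<lambda>\<omega>. Re (Z \<omega>)) \<in> borel_measurable S" "(\<lambda>\<omega>. Im (Z \<omega>)) \<in> borel_measurable S"
    using distributed_measurable[OF re] distributed_measurable[OF im] by simp_all
  have "distr S borel (\<lambda>\<omega>. Re (Z \<omega>)) = ?N" "distr S borel (\<lambda>\<omega>. Im (Z \<omega>)) = ?N"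
    using distributed_distr_eq_density[OF re] distributed_distr_eq_density[OF im]
    by (metis distr_cong sets_lborel)+
  then have "?N \<Otimes>\<^sub>M ?N = distr S (borel \<Otimes>\<^sub>M borel) (\<lambda>\<omega>. (Re (Z \<omega>), Im (Z \<omega>)))"
    using ind indep_var_distribution_eq by metis
  then have "complex_normal = distr (distr S (borel \<Otimes>\<^sub>M borel) (\<lambda>\<omega>. (Re (Z \<omega>), Im (Z \<omega>)))) borel (\<lambda>(x, y). Complex x y)"
    by (simp add: complex_normal_def)
  also have "\<dots> = distr S borel Z"
    by (subst distr_distr) (auto simp: comp_def)
  finally show ?thesis ..
qed

text \<open>If \<open>lam 0\<close> is positive, the complement is the tail event computed above.
  Otherwise all weights are nonpositive, and the sum is almost surely at most 0, hence below
  \<open>t\<close>.\<close>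

lemma PiM_exponential_linear_outage:
  fixes lam :: "nat \<Rightarrow> real"
  assumes "0 < t" "1 \<le> N"
    and nonpos: "\<And>l. l < N \<Longrightarrow> l \<noteq> 0 \<or> lam 0 \<le> 0 \<Longrightarrow> lam l \<le> 0"
  defines "M \<equiv> PiM {..<N} (\<lambda>_. density lborel (exponential_density 1))"
  shows "measure M {x \<in> space M. (\<Sum>l<N. lam l * x l) < t} =
    (if lam 0 > 0
     then 1 - lam 0 ^ (N - 1) / (\<Prod>l\<in>{1..<N}. lam 0 - lam l) * exp (- t / lam 0)
     else 1)"
proof -
  have I: "{..<N} = insert 0 {1..<N}" using \<open>1 \<le> N\<close> by auto
  interpret prob_space M
    unfolding M_def by (intro prob_space_PiM prob_space_exponential_one)
  have [measurable]: "(\<lambda>x. \<Sum>l<N. lam l * x l) \<in> borel_measurable M"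
    unfolding M_def by measurable
  show ?thesis
  proof (cases "lam 0 > 0")
    case True
    have "emeasure M {x \<in> space M. t \<le> (\<Sum>l<N. lam l * x l)}
        = ennreal (exp (- t / lam 0) / (\<Prod>l\<in>{1..<N}. 1 - lam l / lam 0))"
      unfolding M_def I using True \<open>0 < t\<close> nonpos
      by (intro emeasure_PiM_exponential_linear_ge) auto
    \<comment> \<open>One factor \<open>lam 0\<close> for each of the \<open>N - 1\<close> other
      indices: the source of the power in the formula.\<close>
    moreover have factor: "(\<Prod>l\<in>{1..<N}. 1 - lam l / lam 0) = (\<Prod>l\<in>{1..<N}. lam 0 - lam l) / lam 0 ^ (N - 1)"
    proof -
      have "1 - lam l / lam 0 = (lam 0 - lam l) / lam 0" for l
        using True by (simp add: field_simps)
      then show ?thesis by (simp add: prod_dividef)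
    qed
    moreover have "0 \<le> (\<Prod>l\<in>{1..<N}. lam 0 - lam l)"
      using True nonpos by (intro prod_nonneg) (fastforce intro: order_trans[of _ 0])
    ultimately have "prob {x \<in> space M. t \<le> (\<Sum>l<N. lam l * x l)}
        = lam 0 ^ (N - 1) / (\<Prod>l\<in>{1..<N}. lam 0 - lam l) * exp (- t / lam 0)"
      using True by (simp add: measure_def)
    moreover have "prob {x \<in> space M. \<not> t \<le> (\<Sum>l<N. lam l * x l)} = 1 - prob {x \<in> space M. t \<le> (\<Sum>l<N. lam l * x l)}"
      by (rule prob_neg) measurable
    ultimately show ?thesis
      using True by (simp add: not_le)
  next
    case False
    have "AE x in M. \<forall>i\<in>{..<N}. 0 \<le> x i"
      unfolding M_def by (rule AE_PiM_exponential_nonneg) simp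
    then have "AE x in M. (\<Sum>l<N. lam l * x l) < t"
    proof eventually_elim
      case (elim x)
      then have "(\<Sum>l<N. lam l * x l) \<le> 0"
        using False nonpos by (intro sum_nonpos mult_nonpos_nonneg) auto
      then show ?case using \<open>0 < t\<close> by simp
    qed
    moreover have "{x \<in> space M. (\<Sum>l<N. lam l * x l) < t} \<in> events"
      by measurable
    ultimately have "prob {x \<in> space M. (\<Sum>l<N. lam l * x l) < t} = 1"
      by (intro iffD2[OF prob_Collect_eq_1])
    then show ?thesis using False by simp
  qed
qed

text \<open>The total received power is positive, so clearing denominators turns the outage into an
  inequality linear in the signal power \<open>T\<close> and noise power \<open>W\<close>, both
  taken per unit of \<open>PT\<close>.\<close>

lemma mse_gt_iff:
  fixes P \<epsilon> vw PT T W :: real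
  assumes "0 < P" "0 < PT" "0 < vw" "0 < \<epsilon>" "0 \<le> T" "0 \<le> W"
  shows "\<epsilon> < (1 - P * (PT * T) / (PT * W + P * (PT * T) + vw)) * P
    \<longleftrightarrow> T - (P - \<epsilon>) / (\<epsilon> * P) * W < (P - \<epsilon>) * vw / (\<epsilon> * P * PT)"
proof -
  have pos: "0 < PT * W + P * (PT * T) + vw"
    using assms by (intro add_nonneg_pos add_nonneg_nonneg) auto
  have "\<epsilon> < (1 - P * (PT * T) / (PT * W + P * (PT * T) + vw)) * P
      \<longleftrightarrow> \<epsilon> * (PT * W + P * (PT * T) + vw) < (PT * W + vw) * P"
    using pos by (simp add: field_simps)
  also have "\<dots> \<longleftrightarrow> T * (\<epsilon> * P * PT) < ((P - \<epsilon>) / (\<epsilon> * P) * W + (P - \<epsilon>) * vw / (\<epsilon> * P * PT)) * (\<epsilon> * P * PT)"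
  proof -
    have eq: "((P - \<epsilon>) / (\<epsilon> * P) * W + (P - \<epsilon>) * vw / (\<epsilon> * P * PT)) * (\<epsilon> * P * PT) = (P - \<epsilon>) * (PT * W + vw)"
      using assms by (simp add: field_simps)
    show ?thesis unfolding eq by (simp add: algebra_simps)
  qed
  also have "\<dots> \<longleftrightarrow> T < (P - \<epsilon>) / (\<epsilon> * P) * W + (P - \<epsilon>) * vw / (\<epsilon> * P * PT)"
    using assms by (intro mult_less_cancel_right_pos) auto
  finally show ?thesis by (simp add: algebra_simps)
qed

theorem mainTheorem7:
  fixes S :: "'a measure"
    and N :: nat
    and v\<theta> vw P PT \<gamma> \<epsilon> :: real
    and vv d lam :: "nat \<Rightarrow> real"
    and ht :: "nat \<Rightarrow> 'a \<Rightarrow> complex"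
  assumes "prob_space S"
    and "1 \<le> N"
    and "0 < v\<theta>" and "0 < vw" and "0 < P" and "0 < PT" and "0 < \<gamma>"
    and "\<And>i. i < N \<Longrightarrow> 0 < vv i"
    and "\<And>i. i < N \<Longrightarrow> 0 < d i"
    and "0 < \<epsilon>" and "\<epsilon> < P"
    and "prob_space.indep_vars S (\<lambda>_. borel) ht {..<N}"
    and "\<And>i. i < N \<Longrightarrow> std_complex_normal S (ht i)"
    and "decreasing_eigenvalues N (R_mat N PT v\<theta> vv \<gamma> d P \<epsilon>) lam"
  shows "\<P>(\<omega> in S. mse N P vw vv (equal_gain N PT v\<theta> vv) (channel \<gamma> d (\<lambda>i. ht i \<omega>)) > \<epsilon>) =
    (if lam 0 > 0
     then 1 - lam 0 ^ (N - 1) / (\<Prod>l\<in>{1..<N}. lam 0 - lam l) *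
              exp (- ((P - \<epsilon>) * vw / (\<epsilon> * P * PT * lam 0)))
     else 1)"
proof -
  interpret prob_space S by fact
  define b where "b = channel_coeff N v\<theta> vv \<gamma> d"
  define c where "c i = (P - \<epsilon>) / (\<epsilon> * P) * vv i * (b i)\<^sup>2" for i
  define t where "t = (P - \<epsilon>) * vw / (\<epsilon> * P * PT)"
  let ?X = "\<lambda>z. (cmod (\<Sum>i<N. of_real (b i) * z i))\<^sup>2 - (\<Sum>i<N. c i * (cmod (z i))\<^sup>2)"
  let ?Z = "PiM {..<N} (\<lambda>_. complex_normal)"
  let ?E = "PiM {..<N} (\<lambda>_. density lborel (exponential_density 1))"
  have t: "0 < t" using assms(4-6,10,11) by (simp add: t_def)
  have b: "b i \<noteq> 0" and c: "0 < c i" if "i < N" for i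
  proof -
    show "b i \<noteq> 0"
      using assms(3) assms(8)[OF that] assms(9)[OF that] that by (simp add: b_def channel_coeff_def)
    then show "0 < c i"
      using assms(5,10,11) assms(8)[OF that] by (simp add: c_def)
  qed
  \<comment> \<open>The characteristic polynomial is complex; it is evaluated at a real point and
    the identity is pulled back along the injective \<open>of_real\<close>.\<close>
  have secular: "(\<Prod>i<N. s + c i) * (1 - (\<Sum>i<N. (b i)\<^sup>2 / (s + c i))) = (\<Prod>l<N. s - lam l)"
    if "\<And>i. i < N \<Longrightarrow> s + c i \<noteq> 0" for s
  proof -
    have nz: "complex_of_real s + of_real (c i) \<noteq> 0" if "i < N" for i
      using \<open>\<And>i. i < N \<Longrightarrow> s + c i \<noteq> 0\<close>[OF that] by (metis of_real_add of_real_eq_0_iff)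
    have "R_mat N PT v\<theta> vv \<gamma> d P \<epsilon> = Matrix.mat N N (\<lambda>(i, j). complex_of_real (b i) * of_real (b j)
        - (if i = j then of_real (c i) else 0))"
      unfolding b_def c_def using assms(3,6,8) by (intro R_mat_rank_one_minus_diag add_pos_pos) auto
    then have "poly (\<Prod>l<N. [:- complex_of_real (lam l), 1:]) (of_real s)
        = (\<Prod>i<N. complex_of_real s + of_real (c i)) * (1 - (\<Sum>i<N. (of_real (b i))\<^sup>2 / (of_real s + of_real (c i))))"
      using assms(14) poly_char_poly_rank_one_minus_diag[of N "complex_of_real s" "\<lambda>i. of_real (c i)" "\<lambda>i. of_real (b i)", OF nz]
      by (simp add: decreasing_eigenvalues_def)
    then have "complex_of_real (\<Prod>l<N. s - lam l)
        = of_real ((\<Prod>i<N. s + c i) * (1 - (\<Sum>i<N. (b i)\<^sup>2 / (s + c i))))"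
      by (simp add: poly_prod)
    then show ?thesis by (simp only: of_real_eq_iff)
  qed
  \<comment> \<open>If \<open>lam 0\<close> is nonpositive the ordering suffices; if it is positive,
    it is the only positive eigenvalue.\<close>
  have nonpos: "lam l \<le> 0" if "l < N" "l \<noteq> 0 \<or> lam 0 \<le> 0" for l
  proof (cases "lam 0 \<le> 0")
    case True
    then show ?thesis
      using assms(14) that(1) by (force simp: decreasing_eigenvalues_def)
  next
    case False
    then show ?thesis
      using eigenvalue_nonpos_of_secular[OF secular c b, of 0 l] that assms(2) by auto
  qed
  have ht: "random_variable borel (ht i)" if "i < N" for i
    using assms(12) that by (auto simp: indep_vars_def)
  \<comment> \<open>Independence as a product law of the random vector. The vector is restricted to
    \<open>{..<N}\<close> because product measures live on functions fixed outside the index set;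
    the sums only read indices below \<open>N\<close>.\<close>
  have "distr S (PiM {..<N} (\<lambda>_. borel)) (\<lambda>\<omega>. \<lambda>i\<in>{..<N}. ht i \<omega>) = PiM {..<N} (\<lambda>i. distr S borel (ht i))"
    using indep_vars_iff_distr_eq_PiM'[where I = "{..<N}" and M' = "\<lambda>_. borel" and X = ht] assms(2,12) ht
    by (auto simp: lessThan_empty_iff)
  also have "\<dots> = ?Z"
    using assms(1,13) by (intro PiM_cong) (auto simp: distr_std_complex_normal)
  finally have joint: "distr S (PiM {..<N} (\<lambda>_. borel)) (\<lambda>\<omega>. \<lambda>i\<in>{..<N}. ht i \<omega>) = ?Z" .
  have vec [measurable]: "(\<lambda>\<omega>. \<lambda>i\<in>{..<N}. ht i \<omega>) \<in> S \<rightarrow>\<^sub>M PiM {..<N} (\<lambda>_. borel)"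
    using ht by (intro measurable_restrict) auto
  have X [measurable]: "?X \<in> borel_measurable (PiM {..<N} (\<lambda>_. borel))" by measurable
  have Y [measurable]: "(\<lambda>x. \<Sum>l<N. lam l * x l) \<in> borel_measurable ?E" by measurable
  have "distr S borel (\<lambda>\<omega>. ?X (\<lambda>i\<in>{..<N}. ht i \<omega>)) = distr ?Z borel ?X"
    unfolding joint[symmetric] by (subst distr_distr) (auto simp: comp_def)
  also have "\<dots> = distr ?E borel (\<lambda>x. \<Sum>l<N. lam l * x l)"
    by (rule distr_rank_one_minus_diag_form[OF secular])
  finally have law: "distr S borel (\<lambda>\<omega>. ?X (\<lambda>i\<in>{..<N}. ht i \<omega>)) = distr ?E borel (\<lambda>x. \<Sum>l<N. lam l * x l)" .
  have "mse N P vw vv (equal_gain N PT v\<theta> vv) (channel \<gamma> d (\<lambda>i. ht i \<omega>)) > \<epsilon>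
      \<longleftrightarrow> ?X (\<lambda>i\<in>{..<N}. ht i \<omega>) < t" for \<omega>
  proof -
    let ?W = "\<Sum>i<N. vv i * (b i)\<^sup>2 * (cmod (ht i \<omega>))\<^sup>2"
    have "0 \<le> ?W"
      using assms(8) by (intro sum_nonneg) (auto simp: less_imp_le)
    moreover have "(\<Sum>i<N. c i * (cmod (ht i \<omega>))\<^sup>2) = (P - \<epsilon>) / (\<epsilon> * P) * ?W"
      by (simp add: c_def sum_distrib_left mult.assoc)
    ultimately show ?thesis
      using mse_gt_iff[OF assms(5,6,4,10), of "(cmod (\<Sum>i<N. of_real (b i) * ht i \<omega>))\<^sup>2" ?W] assms(6)
      by (simp add: mse_def signal_power_equal_gain obs_noise_power_equal_gain b_def[symmetric] t_def)
  qed
  moreover have "(\<lambda>\<omega>. ?X (\<lambda>i\<in>{..<N}. ht i \<omega>)) \<in> borel_measurable S"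
    by (rule measurable_compose[OF vec X])
  \<comment> \<open>The outage event is the preimage of \<open>{..<t}\<close> under the quadratic
    form, so its probability depends only on the law of that form, and \<open>law\<close> can
    replace it.\<close>
  ultimately have "\<P>(\<omega> in S. mse N P vw vv (equal_gain N PT v\<theta> vv) (channel \<gamma> d (\<lambda>i. ht i \<omega>)) > \<epsilon>)
      = measure (distr S borel (\<lambda>\<omega>. ?X (\<lambda>i\<in>{..<N}. ht i \<omega>))) {..<t}"
    by (subst measure_distr) (auto simp: vimage_def Int_def conj_commute intro!: arg_cong[where f = prob])
  also have "\<dots> = measure ?E {x \<in> space ?E. (\<Sum>l<N. lam l * x l) < t}"
    unfolding law
    by (subst measure_distr) (auto simp: vimage_def Int_def conj_commute intro!: arg_cong[where f = "measure ?E"])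
  also have "\<dots> = (if lam 0 > 0
      then 1 - lam 0 ^ (N - 1) / (\<Prod>l\<in>{1..<N}. lam 0 - lam l) * exp (- t / lam 0) else 1)"
    by (rule PiM_exponential_linear_outage[OF t assms(2) nonpos])
  also have "- t / lam 0 = - ((P - \<epsilon>) * vw / (\<epsilon> * P * PT * lam 0))"
    by (simp add: t_def)
  finally show ?thesis .
qed

end
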